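(* Let $X=X(\mathbb T)$ be a Banach lattice on $\mathbb T$ satisfying Assumption A, let $r,s\in\mathbb N$, and let $K_{n,r}$ be the Kantorovich-type operators described in the context, with $K_{0,r}:=0$. Then there is a constant $C>0$, independent of $f$ and $n$, such that for all $f\in X$ and all $n\in\mathbb N$ $$\|(I-\dot A_{\gamma/n})^s f\|_X\le\frac{C}{n^s}\sum_{\nu=0}^{n}(\nu+1)^{s-1}\|f-K_{\nu,r}f\|_X .$$
   Context: **Banach lattice.** $\mathbb T$ is the unit circle, identified with $[-\pi,\pi)$ (functions are $2\pi$-periodic), and $\mu$ is the normalized Lebesgue measure on $\mathbb T$. A Banach lattice $X$ on $\mathbb T$ is a Banach space of measurable functions on $\mathbb T$ with norm $\|\cdot\|_X$ such that: (1) if $f$ is measurable, $g\in X$ and $|f|\le|g|$, then $f\in X$ and $\|f\|_X\le\|g\|_X$; (2) if $f_n\in X$, $\sup_n\|f_n\|_X<\infty$ and $0\le f_n\uparrow f$, then $f\in X$ and $\|f_n\|_X\to\|f\|_X$; (3) if $E\subset\mathbb T$ is measurable with $\mu(E)<\infty$, then $\chi_E\in X$ and there is $c_E>0$ with $\int_E|f|\,d\mu\le c_E\|f\|_X$ for all $f\in X$. **Steklov averages.** For locally integrable $f$ and $h>0$: $A_hf(x)=\frac1h\int_{x-h/2}^{x+h/2}f(t)\,dt$, $\dot A_hf(x)=A_hf(x+h/2)=\frac1h\int_x^{x+h}f(t)\,dt$, and $A_{h,r}f=\sum_{k=1}^r(-1)^{k+1}\binom rk A_h^kf=f-(I-A_h)^rf$.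 **Assumption A.** For all $f\in X$ and $h>0$, $A_hf\in X$, and $\sup_{h>0}\sup_{\|f\|_X\le1}\|A_hf\|_X<\infty$. **Spaces $\Phi_n$.** $(\Phi_n)_n$ is a nested family of linear subspaces of $X$ ($\Phi_m\subset\Phi_n$ for $m\le n$, $\Phi_0=\{0\}$) satisfying the Bernstein inequality: there is $B>0$ depending only on $X$ with $\|\varphi^{(k)}\|_X\le(Bn)^k\|\varphi\|_X$ for all $k\in\mathbb N$, $\varphi\in\Phi_n$ (in particular the derivatives exist and lie in $X$). **Operators.** For each $n\in\mathbb N$, $\varphi_{k,n}\in\Phi_n$, $k=1,\dots,m_n$, are $2\pi$-periodic functions and $(x_{k,n})_{k=1}^{m_n}\subset\mathbb T$ are points for which there are positive constants $\gamma,\gamma'$ (independent of $n,k$) with $\frac{\gamma}{n}\le x_{k+1,n}-x_{k,n}\le\frac{\gamma'}{n}$, $k=1,\dots,m_n$, where $x_{m_n+1,n}=2\pi+x_{1,n}$. Then $K_{n,r}f(x)=\sum_{k=1}^{m_n}A_{\gamma/n,r}f(x_{k,n})\,\varphi_{k,n}(x)$ for $n\in\mathbb N$. *)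

theory Defs
  imports "HOL-Analysis.Analysis"
begin

text \<open>
  Functions on the circle are \<open>2\<pi>\<close>-periodic functions on the real line with values in
  the scalar field \<open>'a\<close>. The sort \<open>{real_normed_field, euclidean_space}\<close> is satisfied by
  \<open>real\<close> and \<open>complex\<close>, so both scalar fields are covered. Elements of function spaces are
  functions, not equivalence classes; null functions are accounted for in the definition of
  a norm.
\<close>

definition circle_measure :: "real measure" where
  "circle_measure = scale_measure (ennreal (1 / (2 * pi))) (lebesgue_on {-pi..<pi})"

definition circle_measurable :: "(real \<Rightarrow> 'a::{real_normed_field, euclidean_space}) \<Rightarrow> bool" where
  "circle_measurable f \<longleftrightarrow> f \<in> borel_measurable lebesgue \<and> (\<forall>x. f (x + 2 * pi) = f x)"

text \<open>The \<open>2\<pi>\<close>-periodic extension of the characteristic function of \<open>E \<subseteq> [-\<pi>, \<pi>)\<close>.\<close>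

definition circle_indicator :: "real set \<Rightarrow> real \<Rightarrow> 'a::{real_normed_field, euclidean_space}" where
  "circle_indicator E = indicator {x. \<exists>j::int. x + 2 * pi * of_int j \<in> E}"

definition linear_space :: "(real \<Rightarrow> 'a::{real_normed_field, euclidean_space}) set \<Rightarrow> bool" where
  "linear_space V \<longleftrightarrow> (\<lambda>x. 0) \<in> V
     \<and> (\<forall>f\<in>V. \<forall>g\<in>V. (\<lambda>x. f x + g x) \<in> V)
     \<and> (\<forall>c. \<forall>f\<in>V. (\<lambda>x. c * f x) \<in> V)"

definition banach_space_on_circle ::
  "(real \<Rightarrow> 'a::{real_normed_field, euclidean_space}) set \<Rightarrow> ((real \<Rightarrow> 'a) \<Rightarrow> real) \<Rightarrow> bool" where
  "banach_space_on_circle X N \<longleftrightarrow>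
     linear_space X \<and> (\<forall>f\<in>X. circle_measurable f)
     \<and> (\<forall>f\<in>X. 0 \<le> N f \<and> (N f = 0 \<longleftrightarrow> (AE x in circle_measure. f x = 0)))
     \<and> (\<forall>f\<in>X. \<forall>g\<in>X. N (\<lambda>x. f x + g x) \<le> N f + N g)
     \<and> (\<forall>c. \<forall>f\<in>X. N (\<lambda>x. c * f x) = norm c * N f)
     \<and> (\<forall>F::nat \<Rightarrow> real \<Rightarrow> 'a. (\<forall>n. F n \<in> X)
          \<and> (\<forall>e>0. \<exists>M. \<forall>m\<ge>M. \<forall>n\<ge>M. N (\<lambda>x. F m x - F n x) < e)
          \<longrightarrow> (\<exists>f\<in>X. (\<lambda>n. N (\<lambda>x. F n x - f x)) \<longlonglongrightarrow> 0))"

text \<open>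
  The last three conjuncts are the lattice property, the Fatou property, and the requirement
  that bounded functions lie in \<open>X\<close> and \<open>X\<close> embeds in \<open>L\<^sup>1\<close>; the circle having finite
  measure, the last one concerns every measurable set. Pointwise relations between functions
  are understood almost everywhere.
\<close>

definition banach_lattice_on_circle ::
  "(real \<Rightarrow> 'a::{real_normed_field, euclidean_space}) set \<Rightarrow> ((real \<Rightarrow> 'a) \<Rightarrow> real) \<Rightarrow> bool" where
  "banach_lattice_on_circle X N \<longleftrightarrow>
     banach_space_on_circle X N
     \<and> (\<forall>f. \<forall>g\<in>X. circle_measurable f \<and> (AE x in circle_measure. norm (f x) \<le> norm (g x))
          \<longrightarrow> f \<in> X \<and> N f \<le> N g)
     \<and> (\<forall>(F::nat \<Rightarrow> real \<Rightarrow> real) (f::real \<Rightarrow> real).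
          (\<forall>n. (\<lambda>x. of_real (F n x)) \<in> X) \<and> bdd_above (range (\<lambda>n. N (\<lambda>x. of_real (F n x))))
          \<and> circle_measurable f
          \<and> (AE x in circle_measure.
               (\<forall>n. 0 \<le> F n x) \<and> incseq (\<lambda>n. F n x) \<and> (\<lambda>n. F n x) \<longlonglongrightarrow> f x)
          \<longrightarrow> (\<lambda>x. of_real (f x)) \<in> X
              \<and> (\<lambda>n. N (\<lambda>x. of_real (F n x))) \<longlonglongrightarrow> N (\<lambda>x. of_real (f x)))
     \<and> (\<forall>E\<in>sets circle_measure. circle_indicator E \<in> X
          \<and> (\<exists>c>0. \<forall>f\<in>X. (\<integral>\<^sup>+x\<in>E. ennreal (norm (f x)) \<partial>circle_measure) \<le> ennreal (c * N f)))"

definition steklov :: "real \<Rightarrow> (real \<Rightarrow> 'a::{real_normed_field, euclidean_space}) \<Rightarrow> real \<Rightarrow> 'a" where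
  "steklov h f x = (1 / h) *\<^sub>R (LINT t:{x - h / 2..x + h / 2}|lebesgue. f t)"

definition steklov_shifted ::
  "real \<Rightarrow> (real \<Rightarrow> 'a::{real_normed_field, euclidean_space}) \<Rightarrow> real \<Rightarrow> 'a" where
  "steklov_shifted h f x = steklov h f (x + h / 2)"

definition steklov_comb ::
  "real \<Rightarrow> nat \<Rightarrow> (real \<Rightarrow> 'a::{real_normed_field, euclidean_space}) \<Rightarrow> real \<Rightarrow> 'a" where
  "steklov_comb h r f x =
     (\<Sum>k=1..r. (-1) ^ (k + 1) * of_nat (r choose k) * (steklov h ^^ k) f x)"

definition assumption_A ::
  "(real \<Rightarrow> 'a::{real_normed_field, euclidean_space}) set \<Rightarrow> ((real \<Rightarrow> 'a) \<Rightarrow> real) \<Rightarrow> bool" where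
  "assumption_A X N \<longleftrightarrow>
     (\<forall>f\<in>X. \<forall>h>0. steklov h f \<in> X)
     \<and> (\<exists>M. \<forall>h>0. \<forall>f\<in>X. N f \<le> 1 \<longrightarrow> N (steklov h f) \<le> M)"

definition iter_deriv ::
  "nat \<Rightarrow> (real \<Rightarrow> 'a::{real_normed_field, euclidean_space}) \<Rightarrow> real \<Rightarrow> 'a" where
  "iter_deriv k f = ((\<lambda>g x. vector_derivative g (at x)) ^^ k) f"

definition bernstein_family ::
  "(real \<Rightarrow> 'a::{real_normed_field, euclidean_space}) set \<Rightarrow> ((real \<Rightarrow> 'a) \<Rightarrow> real)
     \<Rightarrow> (nat \<Rightarrow> (real \<Rightarrow> 'a) set) \<Rightarrow> bool" where
  "bernstein_family X N \<Phi> \<longleftrightarrow>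
     (\<forall>n. linear_space (\<Phi> n) \<and> \<Phi> n \<subseteq> X)
     \<and> (\<forall>m n. m \<le> n \<longrightarrow> \<Phi> m \<subseteq> \<Phi> n)
     \<and> \<Phi> 0 = {\<lambda>x. 0}
     \<and> (\<exists>B>0. \<forall>n. \<forall>f\<in>\<Phi> n. \<forall>k.
          (\<forall>x. iter_deriv k f differentiable (at x))
          \<and> iter_deriv k f \<in> X
          \<and> N (iter_deriv k f) \<le> (B * real n) ^ k * N f)"

text \<open>
  \<open>m n\<close> is the number of nodes at level \<open>n\<close>, and \<open>\<phi> k n\<close>, \<open>p k n\<close> for \<open>1 \<le> k \<le> m n\<close>
  are the functions and the nodes. The extra value \<open>p (m n + 1) n\<close> is the first node
  shifted by one period; in particular \<open>m n \<ge> 1\<close>.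
\<close>

definition kantorovich_data ::
  "(nat \<Rightarrow> (real \<Rightarrow> 'a::{real_normed_field, euclidean_space}) set) \<Rightarrow> real \<Rightarrow> real \<Rightarrow> (nat \<Rightarrow> nat)
     \<Rightarrow> (nat \<Rightarrow> nat \<Rightarrow> real) \<Rightarrow> (nat \<Rightarrow> nat \<Rightarrow> real \<Rightarrow> 'a) \<Rightarrow> bool" where
  "kantorovich_data \<Phi> \<gamma> \<gamma>' m p \<phi> \<longleftrightarrow> 0 < \<gamma> \<and> 0 < \<gamma>' \<and>
     (\<forall>n\<ge>1.
        p (m n + 1) n = 2 * pi + p 1 n
        \<and> (\<forall>k\<in>{1..m n}. \<phi> k n \<in> \<Phi> n \<and> p k n \<in> {-pi..<pi}
             \<and> \<gamma> / real n \<le> p (k + 1) n - p k n \<and> p (k + 1) n - p k n \<le> \<gamma>' / real n))"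

definition kantorovich ::
  "real \<Rightarrow> (nat \<Rightarrow> nat) \<Rightarrow> (nat \<Rightarrow> nat \<Rightarrow> real) \<Rightarrow> (nat \<Rightarrow> nat \<Rightarrow> real \<Rightarrow> 'a::{real_normed_field, euclidean_space})
     \<Rightarrow> nat \<Rightarrow> nat \<Rightarrow> (real \<Rightarrow> 'a) \<Rightarrow> real \<Rightarrow> 'a" where
  "kantorovich \<gamma> m p \<phi> n r f x =
     (if n = 0 then 0
      else (\<Sum>k=1..m n. steklov_comb (\<gamma> / real n) r f (p k n) * \<phi> k n x))"

end

theory Submission
  imports Defs
begin

text \<open>
  This is an inverse theorem of Bernstein type. Put \<open>h = \<gamma> / n\<close>, let \<open>T\<close> be the \<open>s\<close>-th power
  of the identity minus the one-sided average with step \<open>h\<close>, let \<open>K \<nu>\<close> be the \<open>\<nu>\<close>-th operator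
  applied to \<open>f\<close>, and \<open>a \<nu>\<close> the norm of \<open>f - K \<nu>\<close>. Two properties of \<open>T\<close> carry the proof.

  First, \<open>T\<close> is bounded on \<open>X\<close> uniformly in \<open>h\<close> (\<open>norm_steklov_diff_pow\<close>). The hypothesis gives
  this for centred averages only, but a one-sided average of a nonnegative function is pointwise at
  most twice the centred average with the doubled step, and \<open>X\<close> is a lattice.

  Second, on a smooth function the norm of \<open>T g\<close> is at most a constant times \<open>h ^ s\<close> times the norm
  of the \<open>s\<close>-th derivative of \<open>g\<close> (\<open>norm_steklov_diff_pow_smooth\<close>): for \<open>s = 1\<close> the fundamental
  theorem of calculus dominates \<open>T g\<close> pointwise by the integral of the modulus of the derivative
  over \<open>[x, x + h]\<close>, and \<open>T\<close> commutes with differentiation. By the Bernstein inequality the norm of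
  \<open>T g\<close> is then at most a constant times \<open>(\<nu> / n) ^ s\<close> times the norm of \<open>g\<close> for \<open>g\<close> in
  \<open>\<Phi> \<nu>\<close>. As \<open>K \<mu> \<in> \<Phi> \<mu>\<close> for all \<open>\<mu>\<close> and the spaces are nested, this applies to
  \<open>g = K \<nu> - K \<mu>\<close> with \<open>\<mu> \<le> \<nu>\<close>, whose norm is at most \<open>a \<nu> + a \<mu>\<close>.

  What remains concerns sequences of real numbers (\<open>weighted_inverse_estimate\<close>). Write \<open>f\<close> as
  \<open>f - K \<nu>\<^sub>1\<close> plus the telescoping sum of the differences \<open>K \<nu>\<^sub>j - K \<nu>\<^sub>j\<^sub>+\<^sub>1\<close>, where the levels
  descend from \<open>\<nu>\<^sub>1 \<le> \<nu>\<^sub>0 = n\<close> to \<open>0\<close> roughly by halving and each \<open>\<nu>\<^sub>j\<close> with \<open>j \<ge> 1\<close> minimises \<open>a\<close> on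
  its block.
  Since a minimum is at most an average, \<open>\<nu>\<^sub>j\<^sub>-\<^sub>1 ^ s * a \<nu>\<^sub>j\<close> is at most a constant times the sum of
  \<open>(i + 1) ^ (s - 1) * a i\<close> over that block, and the blocks are disjoint.
\<close>

section \<open>Weighted sums along halved indices\<close>

text \<open>
  Averaging: the upper half of \<open>{0..w}\<close> contains at least \<open>w / 2\<close> indices, and each has
  weight at least \<open>(w / 2) ^ (s - 1)\<close>, so the smallest \<open>a \<mu>\<close> there is controlled by the weighted
  sum over that half.
\<close>

lemma block_minimizer:
  fixes a :: "nat \<Rightarrow> real"
  assumes a: "\<And>i. 0 \<le> a i" and w: "1 \<le> w" and s: "1 \<le> s"
  obtains \<mu> where "\<mu> \<in> {w div 2 + 1..w}"
    and "(real w / 2) ^ s * a \<mu> \<le> (\<Sum>i\<in>{w div 2 + 1..w}. real (i + 1) ^ (s - 1) * a i)"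
proof -
  let ?S = "{w div 2 + 1..w}"
  have S: "finite ?S" "?S \<noteq> {}" using w by auto
  have "Min (a ` ?S) \<in> a ` ?S" using S by (intro Min_in) auto
  then obtain \<mu> where \<mu>: "\<mu> \<in> ?S" "a \<mu> = Min (a ` ?S)" by force
  have min: "a \<mu> \<le> a i" if "i \<in> ?S" for i using \<mu>(2) that by auto
  have "(real w / 2) ^ s * a \<mu> = (real w / 2) * ((real w / 2) ^ (s - 1) * a \<mu>)"
    using s by (cases s) auto
  also have "\<dots> \<le> real (card ?S) * ((real w / 2) ^ (s - 1) * a \<mu>)"
    by (intro mult_right_mono mult_nonneg_nonneg a) (auto simp: of_nat_diff field_simps)
  also have "\<dots> \<le> (\<Sum>i\<in>?S. real (i + 1) ^ (s - 1) * a i)"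
    by (intro sum_bounded_below mult_mono power_mono min a) auto
  finally show ?thesis using \<mu>(1) that by blast
qed

lemma weighted_sum_split:
  fixes a :: "nat \<Rightarrow> real"
  assumes a: "\<And>i. 0 \<le> a i" and "k \<le> w div 2"
  shows "(\<Sum>i=0..k. real (i + 1) ^ q * a i) + (\<Sum>i\<in>{w div 2 + 1..w}. real (i + 1) ^ q * a i)
    \<le> (\<Sum>i=0..w. real (i + 1) ^ q * a i)"
proof -
  have "(\<Sum>i=0..k. real (i + 1) ^ q * a i) + (\<Sum>i\<in>{w div 2 + 1..w}. real (i + 1) ^ q * a i)
      = (\<Sum>i\<in>{0..k} \<union> {w div 2 + 1..w}. real (i + 1) ^ q * a i)"
    using assms by (intro sum.union_disjoint[symmetric]) auto
  also have "\<dots> \<le> (\<Sum>i=0..w. real (i + 1) ^ q * a i)"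
    using assms by (intro sum_mono2) auto
  finally show ?thesis .
qed

text \<open>
  Choose \<open>\<mu>\<close> by \<open>block_minimizer\<close> in the upper half of \<open>{0..\<nu> div 2}\<close>, step from \<open>\<nu>\<close> to
  \<open>\<mu>\<close>, and iterate. The indices drop at least by half each time, so the halves used are disjoint and
  their weighted sums add up to a single one. The term \<open>\<nu> ^ s * a \<nu>\<close> is kept apart with coefficient
  1 because in the next step it has the form \<open>\<mu> ^ s * a \<mu>\<close>, and together with the new term
  \<open>\<nu> ^ s * a \<mu>\<close> it must fit into \<open>2 * 6 ^ s\<close> times the sum over the block. The factor \<open>6 ^ s\<close> comes from
  \<open>\<nu> \<le> 2 * w + 1 \<le> 3 * w = 6 * (w / 2)\<close> with \<open>w = \<nu> div 2 \<ge> 1\<close>.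
\<close>

lemma halving_telescope:
  fixes a b :: "nat \<Rightarrow> real"
  assumes a: "\<And>i. 0 \<le> a i" and D: "0 \<le> D" and s: "1 \<le> s"
    and b0: "b 0 = 0"
    and step: "\<And>\<mu> \<nu>. \<mu> \<le> \<nu> \<Longrightarrow> b \<nu> \<le> b \<mu> + D * real \<nu> ^ s * (a \<nu> + a \<mu>)"
  shows "b \<nu> \<le> D * (real \<nu> ^ s * a \<nu> + 2 * 6 ^ s * (\<Sum>i=0..\<nu> div 2. real (i + 1) ^ (s - 1) * a i))"
proof (induction \<nu> rule: less_induct)
  case (less \<nu>)
  define w where "w = \<nu> div 2"
  let ?S = "\<lambda>k. \<Sum>i=0..k. real (i + 1) ^ (s - 1) * a i"
  show ?case
    \<comment> \<open>For \<open>\<nu> \<le> 1\<close> there is no block left, and one step leads to \<open>b 0 = 0\<close>.\<close>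
  proof (cases "w = 0")
    case True
    have "real \<nu> ^ s * a 0 \<le> 1 * a 0"
      using True by (intro mult_right_mono power_le_one a) (auto simp: w_def)
    also have "\<dots> \<le> (2 * 6 ^ s) * a 0"
      using one_le_power[of "6::real" s] by (intro mult_right_mono a) linarith
    finally have "D * (real \<nu> ^ s * a 0) \<le> D * (2 * 6 ^ s * a 0)"
      by (intro mult_left_mono D) auto
    then show ?thesis using step[of 0 \<nu>] b0 True by (simp add: w_def algebra_simps)
  next
    case False
    then have w1: "1 \<le> w" by simp
    obtain \<mu> where \<mu>: "\<mu> \<in> {w div 2 + 1..w}"
      and le: "(real w / 2) ^ s * a \<mu> \<le> (\<Sum>i\<in>{w div 2 + 1..w}. real (i + 1) ^ (s - 1) * a i)"
      (is "_ \<le> ?B") using block_minimizer[of a w s, OF a w1 s] by blast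
    have \<mu>\<nu>: "\<mu> < \<nu>" using \<mu> w1 by (auto simp: w_def)
    have "real \<nu> \<le> 6 * (real w / 2)" using w1 unfolding w_def by linarith
    then have "real \<nu> ^ s * a \<mu> \<le> (6 * (real w / 2)) ^ s * a \<mu>"
      by (intro mult_right_mono power_mono a) auto
    also have "\<dots> = 6 ^ s * ((real w / 2) ^ s * a \<mu>)"
      by (simp only: power_mult_distrib mult.assoc)
    also have "\<dots> \<le> 6 ^ s * ?B" using le by (intro mult_left_mono) auto
    finally have \<nu>B: "real \<nu> ^ s * a \<mu> \<le> 6 ^ s * ?B" .
    have "real \<mu> ^ s * a \<mu> \<le> real \<nu> ^ s * a \<mu>"
      using \<mu>\<nu> by (intro mult_right_mono power_mono a) auto
    then have \<mu>B: "real \<mu> ^ s * a \<mu> \<le> 6 ^ s * ?B" using \<nu>B by simp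
    have "?S (\<mu> div 2) + ?B \<le> ?S w"
      using \<mu> by (intro weighted_sum_split a) (auto intro: div_le_mono)
    then have "2 * 6 ^ s * (?S (\<mu> div 2) + ?B) \<le> 2 * 6 ^ s * ?S w"
      by (intro mult_left_mono) auto
    with \<mu>B \<nu>B have "(real \<mu> ^ s * a \<mu> + 2 * 6 ^ s * ?S (\<mu> div 2)) + real \<nu> ^ s * (a \<nu> + a \<mu>)
        \<le> real \<nu> ^ s * a \<nu> + 2 * 6 ^ s * ?S w"
      by (simp add: algebra_simps)
    from mult_left_mono[OF this D]
    have "D * (real \<mu> ^ s * a \<mu> + 2 * 6 ^ s * ?S (\<mu> div 2)) + D * real \<nu> ^ s * (a \<nu> + a \<mu>)
        \<le> D * (real \<nu> ^ s * a \<nu> + 2 * 6 ^ s * ?S w)"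
      by (simp only: distrib_left mult.assoc)
    then show ?thesis
      using step[of \<mu> \<nu>] less.IH[OF \<mu>\<nu>] \<mu>\<nu> by (simp add: w_def)
  qed
qed

text \<open>
  The inverse theorem with all functions abstracted away: \<open>a \<nu>\<close> is the approximation error at
  level \<open>\<nu>\<close>, \<open>b \<nu>\<close> the smoothness seminorm of the approximant and \<open>e\<close> that of the approximated
  function. A best level \<open>\<mu>\<close> in \<open>{n div 2 + 1..n}\<close> replaces the function by an approximant, to which
  \<open>halving_telescope\<close> applies.
\<close>

lemma weighted_inverse_estimate:
  fixes a b :: "nat \<Rightarrow> real"
  assumes a: "\<And>i. 0 \<le> a i" and D: "0 \<le> D" and M: "0 \<le> M" and s: "1 \<le> s" and n: "1 \<le> n"
    and b0: "b 0 = 0"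
    and step: "\<And>\<mu> \<nu>. \<mu> \<le> \<nu> \<Longrightarrow> b \<nu> \<le> b \<mu> + D / real n ^ s * real \<nu> ^ s * (a \<nu> + a \<mu>)"
    and e: "\<And>\<mu>. e \<le> M * a \<mu> + b \<mu>"
  shows "e \<le> (2 ^ s * (M + D) + 2 * 6 ^ s * D) / real n ^ s * (\<Sum>i=0..n. real (i + 1) ^ (s - 1) * a i)"
proof -
  let ?S = "\<lambda>k. \<Sum>i=0..k. real (i + 1) ^ (s - 1) * a i"
  let ?N = "real n ^ s"
  have N: "?N > 0" using n by simp
  obtain \<mu> where \<mu>: "\<mu> \<in> {n div 2 + 1..n}"
    and le: "(real n / 2) ^ s * a \<mu> \<le> (\<Sum>i\<in>{n div 2 + 1..n}. real (i + 1) ^ (s - 1) * a i)"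
    (is "_ \<le> ?B") using block_minimizer[of a n s, OF a n s] by blast
  have "?S (\<mu> div 2) + ?B \<le> ?S n"
    using \<mu> by (intro weighted_sum_split a) (auto intro: div_le_mono)
  moreover have "0 \<le> ?S (\<mu> div 2)" "0 \<le> ?B" by (intro sum_nonneg mult_nonneg_nonneg a; simp)+
  ultimately have B: "?B \<le> ?S n" and S: "?S (\<mu> div 2) \<le> ?S n" by linarith+
  have "?N * a \<mu> = 2 ^ s * ((real n / 2) ^ s * a \<mu>)" by (simp add: power_divide)
  also have "\<dots> \<le> 2 ^ s * ?S n" using le B by (intro mult_left_mono) auto
  finally have aB: "?N * a \<mu> \<le> 2 ^ s * ?S n" .
  have "real \<mu> ^ s * a \<mu> \<le> ?N * a \<mu>" using \<mu> by (intro mult_right_mono power_mono a) auto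
  then have \<mu>B: "real \<mu> ^ s * a \<mu> \<le> 2 ^ s * ?S n" using aB by simp
  have "b \<mu> \<le> D / ?N * (real \<mu> ^ s * a \<mu> + 2 * 6 ^ s * ?S (\<mu> div 2))"
    using D N by (intro halving_telescope a s b0 step) auto
  then have "?N * b \<mu> \<le> ?N * (D / ?N * (real \<mu> ^ s * a \<mu> + 2 * 6 ^ s * ?S (\<mu> div 2)))"
    using N by (intro mult_left_mono) auto
  also have "\<dots> = D * (real \<mu> ^ s * a \<mu> + 2 * 6 ^ s * ?S (\<mu> div 2))" using N by simp
  also have "\<dots> \<le> D * (2 ^ s * ?S n + 2 * 6 ^ s * ?S n)"
    using \<mu>B S by (intro mult_left_mono D add_mono) auto
  finally have bN: "?N * b \<mu> \<le> D * (2 ^ s * ?S n + 2 * 6 ^ s * ?S n)" .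
  have "?N * e \<le> ?N * (M * a \<mu> + b \<mu>)" using e N by (intro mult_left_mono) auto
  also have "\<dots> = M * (?N * a \<mu>) + ?N * b \<mu>" by (simp add: algebra_simps)
  also have "\<dots> \<le> M * (2 ^ s * ?S n) + D * (2 ^ s * ?S n + 2 * 6 ^ s * ?S n)"
    using aB bN by (intro add_mono mult_left_mono M) auto
  also have "\<dots> = (2 ^ s * (M + D) + 2 * 6 ^ s * D) * ?S n" by (simp add: algebra_simps)
  finally show ?thesis using N by (simp add: field_simps)
qed

section \<open>Local integrability of periodic functions\<close>

lemma measurable_translate:
  assumes "f \<in> borel_measurable lebesgue"
  shows "(\<lambda>x::real. f (x + c)) \<in> borel_measurable lebesgue"
proof -
  have "(\<lambda>x::real. c + 1 * x) \<in> lebesgue \<rightarrow>\<^sub>M lebesgue"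
    using lebesgue_affine_measurable[of "\<lambda>_::real. 1" c] by (simp)
  from measurable_compose[OF this assms] show ?thesis by (simp add: add.commute)
qed

lemma set_integrable_translate:
  fixes f :: "real \<Rightarrow> 'a::euclidean_space"
  assumes f: "f \<in> borel_measurable lebesgue" and A: "A \<in> sets lebesgue"
    and B: "B \<in> sets lebesgue"
    and AB: "\<And>x. x \<in> A \<longleftrightarrow> x + c \<in> B" and per: "\<And>x. f (x + c) = f x"
    and int: "set_integrable lebesgue A f"
  shows "set_integrable lebesgue B f"
proof -
  have m: "(\<lambda>x. indicator B x *\<^sub>R f x) \<in> borel_measurable lebesgue" using f B by measurable
  have "(\<integral>\<^sup>+x. ennreal (norm (indicator B x *\<^sub>R f x)) \<partial>lebesgue)
      = (\<integral>\<^sup>+x. ennreal (norm (indicator B (c + 1 * x) *\<^sub>R f (c + 1 * x))) \<partial>lebesgue)"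
    using measurable_compose[OF measurable_compose[OF m borel_measurable_norm] measurable_ennreal]
    by (subst nn_integral_real_affine_lebesgue[where c=1 and t=c]) simp_all
  also have "\<dots> = (\<integral>\<^sup>+x. ennreal (norm (indicator A x *\<^sub>R f x)) \<partial>lebesgue)"
    using AB per by (intro nn_integral_cong) (auto simp: indicator_def add.commute)
  also have "\<dots> < \<infinity>"
    using int unfolding set_integrable_def integrable_iff_bounded by auto
  finally show ?thesis using m unfolding set_integrable_def integrable_iff_bounded by auto
qed

lemma periodic_locally_integrable:
  fixes f :: "real \<Rightarrow> 'a::{real_normed_field, euclidean_space}"
  assumes f: "circle_measurable f" and int: "set_integrable lebesgue {-pi..<pi} f"
  shows "set_integrable lebesgue {a..b} f"
proof -
  have per1: "f (x + 2 * pi * of_nat j) = f x" for x j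
  proof (induction j)
    case (Suc j)
    have "f ((x + 2 * pi * of_nat j) + 2 * pi) = f (x + 2 * pi * of_nat j)"
      using f unfolding circle_measurable_def by blast
    then show ?case using Suc by (simp add: algebra_simps)
  qed simp
  have per: "f (x + 2 * pi * of_int j) = f x" for x j
  proof (cases "0 \<le> j")
    case True then show ?thesis using per1[of x "nat j"] by simp
  next
    case False then show ?thesis using per1[of "x + 2 * pi * of_int j" "nat (-j)"] by simp
  qed
  define P where "P j = {-pi + 2 * pi * of_int j..<pi + 2 * pi * of_int j}" for j :: int
  have P: "set_integrable lebesgue (P j) f" for j
    by (rule set_integrable_translate[where c = "2 * pi * of_int j", OF _ _ _ _ per int])
       (use f in \<open>auto simp: P_def circle_measurable_def\<close>)
  let ?q = "\<lambda>x. \<lfloor>(x + pi) / (2 * pi)\<rfloor>"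
  have "set_integrable lebesgue (\<Union>j\<in>{?q a..?q b}. P j) f"
    by (intro set_integrable_UN P) (auto simp: P_def)
  moreover have "{a..b} \<subseteq> (\<Union>j\<in>{?q a..?q b}. P j)"
  proof
    fix x assume x: "x \<in> {a..b}"
    have "?q a \<le> ?q x" "?q x \<le> ?q b" using x by (auto intro!: floor_mono divide_right_mono)
    moreover have "x \<in> P (?q x)"
      using floor_correct[of "(x + pi) / (2 * pi)"]
      by (simp add: P_def le_divide_eq divide_less_eq algebra_simps)
    ultimately show "x \<in> (\<Union>j\<in>{?q a..?q b}. P j)" by auto
  qed
  ultimately show ?thesis using set_integrable_subset[of lebesgue _ f "{a..b}"] by simp
qed

text \<open>
  The embedding into \<open>L\<^sup>1\<close> of one period, together with periodicity. Without this the averages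
  would not be additive, since the integral of a non-integrable function is \<open>0\<close> by convention.
\<close>

lemma banach_lattice_set_integrable:
  assumes X: "banach_lattice_on_circle X N" and f: "f \<in> X"
  shows "set_integrable lebesgue {a..b} f"
proof (rule periodic_locally_integrable)
  from X have "banach_space_on_circle X N"
    unfolding banach_lattice_on_circle_def by (elim conjE)
  then have "\<forall>f\<in>X. circle_measurable f"
    unfolding banach_space_on_circle_def by (elim conjE)
  with f show cm: "circle_measurable f" by (rule bspec[rotated])
  then have m: "f \<in> borel_measurable lebesgue" by (simp add: circle_measurable_def)
  have E: "{-pi..<pi} \<in> sets circle_measure"
    by (auto simp: circle_measure_def sets_restrict_space)
  from X have "\<forall>E\<in>sets circle_measure. circle_indicator E \<in> X
          \<and> (\<exists>c>0. \<forall>f\<in>X. (\<integral>\<^sup>+x\<in>E. ennreal (norm (f x)) \<partial>circle_measure) \<le> ennreal (c * N f))"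
    unfolding banach_lattice_on_circle_def by (elim conjE)
  with E f obtain c where "(\<integral>\<^sup>+x\<in>{-pi..<pi}. ennreal (norm (f x)) \<partial>circle_measure) \<le> ennreal (c * N f)"
    by blast
  then have "(\<integral>\<^sup>+x\<in>{-pi..<pi}. ennreal (norm (f x)) \<partial>circle_measure) < \<infinity>"
    unfolding infinity_ennreal_def by (rule le_less_trans) (rule ennreal_less_top)
  moreover have "(\<integral>\<^sup>+x\<in>{-pi..<pi}. ennreal (norm (f x)) \<partial>circle_measure)
      = ennreal (1 / (2 * pi)) * (\<integral>\<^sup>+x\<in>{-pi..<pi}. ennreal (norm (f x)) \<partial>lebesgue_on {-pi..<pi})"
    unfolding circle_measure_def
  proof (rule nn_integral_scale_measure)
    have [measurable]: "f \<in> borel_measurable (lebesgue_on {-pi..<pi})" "{-pi..<pi} \<in> sets (lebesgue_on {-pi..<pi})"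
      using m by (auto intro: measurable_restrict_space1 simp: sets_restrict_space)
    show "(\<lambda>x. ennreal (norm (f x)) * indicator {-pi..<pi} x) \<in> borel_measurable (lebesgue_on {-pi..<pi})"
      by measurable
  qed
  moreover have "(\<integral>\<^sup>+x\<in>{-pi..<pi}. ennreal (norm (f x)) \<partial>lebesgue_on {-pi..<pi})
      = (\<integral>\<^sup>+x. ennreal (norm (indicator {-pi..<pi} x *\<^sub>R f x)) \<partial>lebesgue)"
    by (subst nn_integral_restrict_space) (simp, rule nn_integral_cong, simp add: indicator_def)
  ultimately have "(\<integral>\<^sup>+x. ennreal (norm (indicator {-pi..<pi} x *\<^sub>R f x)) \<partial>lebesgue) < \<infinity>"
    by (auto simp: ennreal_mult_less_top)
  moreover have "(\<lambda>x. indicator {-pi..<pi} x *\<^sub>R f x) \<in> borel_measurable lebesgue"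
    using m by (intro borel_measurable_scaleR borel_measurable_indicator) auto
  ultimately show "set_integrable lebesgue {-pi..<pi} f"
    unfolding set_integrable_def integrable_iff_bounded by auto
qed

section \<open>One-sided averages of differentiable functions\<close>

lemma integral_vector_derivative:
  fixes g :: "real \<Rightarrow> 'a::euclidean_space"
  assumes "\<And>x. g differentiable (at x)" "a \<le> b"
  shows "((\<lambda>x. vector_derivative g (at x)) has_integral (g b - g a)) {a..b}"
  using assms
  by (intro fundamental_theorem_of_calculus)
     (auto simp: vector_derivative_works intro: has_vector_derivative_at_within)

text \<open>
  Near \<open>x\<close> the sliding integral is \<open>F (x + h) - F x\<close> for an antiderivative \<open>F\<close> of \<open>g\<close>.
\<close>

lemma sliding_integral_derivative:
  fixes g :: "real \<Rightarrow> 'a::euclidean_space"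
  assumes g: "continuous_on UNIV g" and h: "0 < h"
  shows "((\<lambda>x. integral {x..x + h} g) has_vector_derivative (g (x + h) - g x)) (at x)"
proof -
  define F where "F u = integral {x - 1..u} g" for u
  have c: "continuous_on S g" for S using g continuous_on_subset by blast
  have F: "(F has_vector_derivative g u) (at u)" if "x - 1 < u" for u
  proof -
    have "(F has_vector_derivative g u) (at u within {x - 1..u + 1})"
      unfolding F_def using that by (intro integral_has_vector_derivative c) auto
    then show ?thesis using that by (simp add: at_within_Icc_at)
  qed
  have "((\<lambda>u. F (u + h)) has_vector_derivative 1 *\<^sub>R g (x + h)) (at x)"
  proof -
    have "((\<lambda>u. u + h) has_vector_derivative 1) (at x)" by (auto intro!: derivative_eq_intros)
    from vector_diff_chain_at[OF this F[of "x + h"]] h show ?thesis by (simp add: o_def)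
  qed
  then have "((\<lambda>u. F (u + h) - F u) has_vector_derivative (g (x + h) - g x)) (at x)"
    using has_vector_derivative_diff[OF _ F[of x]] by simp
  then show ?thesis
  proof (rule has_vector_derivative_transform_within_open[where S = "{x - 1<..}"])
    fix y assume "y \<in> {x - 1<..}"
    then have "F y + integral {y..y + h} g = F (y + h)" unfolding F_def
      using h by (intro Henstock_Kurzweil_Integration.integral_combine integrable_continuous_real c) auto
    then show "F (y + h) - F y = integral {y..y + h} g" by (simp add: algebra_simps)
  qed auto
qed

lemma continuous_LINT_eq_integral:
  fixes g :: "real \<Rightarrow> 'a::euclidean_space"
  assumes "continuous_on UNIV g"
  shows "(LINT t:{a..b}|lebesgue. g t) = integral {a..b} g"
  using assms
  by (intro set_lebesgue_integral_eq_integral absolutely_integrable_continuous_real)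
     (rule continuous_on_subset[OF _ subset_UNIV])

lemma set_integral_norm_mono:
  fixes g :: "real \<Rightarrow> 'a::euclidean_space"
  assumes "set_integrable lebesgue A g" "set_integrable lebesgue B g" "A \<subseteq> B"
  shows "(LINT t:A|lebesgue. norm (g t)) \<le> (LINT t:B|lebesgue. norm (g t))"
  unfolding set_lebesgue_integral_def
proof (rule integral_mono)
  show "integrable lebesgue (\<lambda>x. indicator A x *\<^sub>R norm (g x))"
    "integrable lebesgue (\<lambda>x. indicator B x *\<^sub>R norm (g x))"
    using set_integrable_norm[OF assms(1)] set_integrable_norm[OF assms(2)]
    unfolding set_integrable_def by auto
qed (use assms(3) in \<open>auto simp: indicator_def\<close>)

definition steklov_diff ::
  "real \<Rightarrow> (real \<Rightarrow> 'a::{real_normed_field, euclidean_space}) \<Rightarrow> real \<Rightarrow> 'a" where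
  "steklov_diff h g x = g x - steklov_shifted h g x"

lemma steklov_shifted_eq:
  "steklov_shifted h f x = (1 / h) *\<^sub>R (LINT t:{x..x + h}|lebesgue. f t)"
  by (simp add: steklov_shifted_def steklov_def add.assoc)

lemma steklov_of_real_norm:
  fixes g :: "real \<Rightarrow> 'a::{real_normed_field, euclidean_space}"
  assumes "\<And>a b. set_integrable lebesgue {a..b} g"
  shows "steklov h (\<lambda>x. of_real (norm (g x)) :: 'a) x
    = of_real (1 / h * (LINT t:{x - h / 2..x + h / 2}|lebesgue. norm (g t)))"
proof -
  let ?A = "{x - h / 2..x + h / 2}"
  have "integrable lebesgue (\<lambda>t. indicator ?A t *\<^sub>R norm (g t))"
    using set_integrable_norm[OF assms] unfolding set_integrable_def .
  from integral_bounded_linear[OF bounded_linear_of_real this]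
  have "(LINT t:?A|lebesgue. (of_real (norm (g t)) :: 'a)) = of_real (LINT t:?A|lebesgue. norm (g t))"
    unfolding set_lebesgue_integral_def by (simp add: scaleR_conv_of_real)
  then show ?thesis by (simp add: steklov_def scaleR_conv_of_real)
qed

text \<open>
  Here \<open>g x\<close> minus its mean over \<open>[x, x + h]\<close> is the mean of \<open>g x - g t\<close>, and \<open>g x - g t\<close> is
  the integral of the derivative over a part of \<open>[x, x + h]\<close>. The bound is pointwise, which lets the
  lattice property turn it into a norm bound.
\<close>

lemma norm_steklov_diff_le:
  fixes g :: "real \<Rightarrow> 'a::{real_normed_field, euclidean_space}"
  defines "g' \<equiv> \<lambda>x. vector_derivative g (at x)"
  assumes g: "\<And>x. g differentiable (at x)" and h: "0 < h"
    and int: "\<And>a b. set_integrable lebesgue {a..b} g'"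
  shows "norm (steklov_diff h g x) \<le> (LINT t:{x..x + h}|lebesgue. norm (g' t))" (is "_ \<le> ?L")
proof -
  have cg: "continuous_on S g" for S
    by (intro differentiable_imp_continuous_on differentiable_at_imp_differentiable_on g)
  have bound: "norm (g x - g t) \<le> ?L" if t: "t \<in> {x..x + h}" for t
  proof -
    have "integral {x..t} g' = g t - g x"
      using integral_vector_derivative[OF g, of x t] t unfolding g'_def by (auto intro: integral_unique)
    then have "(LINT u:{x..t}|lebesgue. g' u) = g t - g x"
      by (simp add: set_lebesgue_integral_eq_integral(2)[OF int])
    then have "norm (g x - g t) = norm (LINT u:{x..t}|lebesgue. g' u)"
      by (simp add: norm_minus_commute)
    also have "\<dots> \<le> (LINT u:{x..t}|lebesgue. norm (g' u))" by (rule set_integral_norm_bound[OF int])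
    also have "\<dots> \<le> ?L" using t by (intro set_integral_norm_mono int) auto
    finally show ?thesis .
  qed
  have "integral {x..x + h} (\<lambda>t. g x - g t) = h *\<^sub>R g x - integral {x..x + h} g"
    using h by (subst Henstock_Kurzweil_Integration.integral_diff)
      (auto intro: integrable_continuous_real cg)
  then have "h *\<^sub>R steklov_diff h g x = integral {x..x + h} (\<lambda>t. g x - g t)"
    using h by (simp add: steklov_diff_def steklov_shifted_eq continuous_LINT_eq_integral[OF cg] algebra_simps)
  then have "h * norm (steklov_diff h g x) = norm (integral {x..x + h} (\<lambda>t. g x - g t))"
    using h by (metis abs_of_pos norm_scaleR)
  also have "\<dots> \<le> ?L * (x + h - x)"
    using h bound by (intro integral_bound continuous_intros cg) auto
  finally show ?thesis using h by simp
qed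

text \<open>
  Differentiation commutes with \<open>steklov_diff h\<close>: both the derivative of the average and the average
  of the derivative equal \<open>(g (x + h) - g x) / h\<close>.
\<close>

lemma steklov_diff_has_vector_derivative:
  fixes g :: "real \<Rightarrow> 'a::{real_normed_field, euclidean_space}"
  defines "g' \<equiv> \<lambda>x. vector_derivative g (at x)"
  assumes g: "\<And>x. g differentiable (at x)" and g': "\<And>x. g' differentiable (at x)" and h: "0 < h"
  shows "(steklov_diff h g has_vector_derivative steklov_diff h g' x) (at x)"
proof -
  have cg: "continuous_on UNIV g" and cg': "continuous_on UNIV g'"
    by (intro differentiable_imp_continuous_on differentiable_at_imp_differentiable_on g g')+
  have T: "steklov_diff h g = (\<lambda>x. g x - (1 / h) *\<^sub>R integral {x..x + h} g)"
    by (simp add: fun_eq_iff steklov_diff_def steklov_shifted_eq continuous_LINT_eq_integral[OF cg])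
  have "integral {x..x + h} g' = g (x + h) - g x"
    using integral_vector_derivative[OF g, of x "x + h"] h unfolding g'_def by (auto intro: integral_unique)
  then have T': "steklov_diff h g' x = g' x - (1 / h) *\<^sub>R (g (x + h) - g x)"
    by (simp add: steklov_diff_def steklov_shifted_eq continuous_LINT_eq_integral[OF cg'])
  have "(g has_vector_derivative g' x) (at x)"
    using g unfolding g'_def by (simp add: vector_derivative_works)
  moreover have "((\<lambda>x. (1 / h) *\<^sub>R integral {x..x + h} g) has_vector_derivative
      (1 / h) *\<^sub>R (g (x + h) - g x)) (at x)"
    by (rule bounded_linear.has_vector_derivative[OF bounded_linear_scaleR_right])
       (rule sliding_integral_derivative[OF cg h])
  ultimately show ?thesis
    unfolding T T' by (rule has_vector_derivative_diff)
qed

lemma iter_deriv_Suc: "iter_deriv (Suc k) g = (\<lambda>x. vector_derivative (iter_deriv k g) (at x))"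
  by (simp add: iter_deriv_def)

section \<open>One-sided averages on a Banach lattice\<close>

lemma linear_space_diff:
  assumes V: "linear_space V" and f: "f \<in> V" and g: "g \<in> V"
  shows "(\<lambda>x. f x - g x) \<in> V"
proof -
  have "(\<lambda>x. - 1 * g x) \<in> V" using V g unfolding linear_space_def by (elim conjE) (drule spec, erule (1) bspec)
  moreover have "\<forall>f\<in>V. \<forall>g\<in>V. (\<lambda>x. f x + g x) \<in> V" using V unfolding linear_space_def by (elim conjE)
  ultimately have "(\<lambda>x. f x + - 1 * g x) \<in> V" using f by (auto dest: bspec)
  then show ?thesis by simp
qed

locale steklov_lattice =
  fixes X :: "(real \<Rightarrow> 'a::{real_normed_field, euclidean_space}) set"
    and N :: "(real \<Rightarrow> 'a) \<Rightarrow> real"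
  assumes lattice: "banach_lattice_on_circle X N"
    and bounded_averages: "assumption_A X N"
begin

lemma banach_space: "banach_space_on_circle X N"
  using lattice unfolding banach_lattice_on_circle_def by (elim conjE)

lemma linear: "linear_space X"
  using banach_space unfolding banach_space_on_circle_def by (elim conjE)

lemma zero_mem: "(\<lambda>x. 0) \<in> X"
  and scale_mem: "f \<in> X \<Longrightarrow> (\<lambda>x. c * f x) \<in> X"
  using linear unfolding linear_space_def by blast+

lemma mem_circle_measurable: "f \<in> X \<Longrightarrow> circle_measurable f"
  using banach_space unfolding banach_space_on_circle_def by (elim conjE) (erule bspec)

lemma norm_nonneg: "f \<in> X \<Longrightarrow> 0 \<le> N f"
  using banach_space unfolding banach_space_on_circle_def by (elim conjE) (drule (1) bspec, elim conjE)

lemma norm_zero: "N (\<lambda>x. 0) = 0"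
proof -
  have "\<forall>f\<in>X. 0 \<le> N f \<and> (N f = 0 \<longleftrightarrow> (AE x in circle_measure. f x = 0))"
    using banach_space unfolding banach_space_on_circle_def by (elim conjE)
  from bspec[OF this zero_mem] show ?thesis by simp
qed

lemma norm_triangle: "f \<in> X \<Longrightarrow> g \<in> X \<Longrightarrow> N (\<lambda>x. f x + g x) \<le> N f + N g"
  using banach_space unfolding banach_space_on_circle_def by (elim conjE) (drule (1) bspec, drule (1) bspec)

lemma norm_scale: "f \<in> X \<Longrightarrow> N (\<lambda>x. c * f x) = norm c * N f"
proof -
  have "\<forall>c. \<forall>f\<in>X. N (\<lambda>x. c * f x) = norm c * N f"
    using banach_space unfolding banach_space_on_circle_def by (elim conjE)
  then show "f \<in> X \<Longrightarrow> N (\<lambda>x. c * f x) = norm c * N f" by blast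
qed

lemma diff_mem: "f \<in> X \<Longrightarrow> g \<in> X \<Longrightarrow> (\<lambda>x. f x - g x) \<in> X"
  by (rule linear_space_diff[OF linear])

lemma norm_diff: "f \<in> X \<Longrightarrow> g \<in> X \<Longrightarrow> N (\<lambda>x. f x - g x) \<le> N f + N g"
  using norm_triangle[OF _ scale_mem[of g "-1"], of f] norm_scale[of g "-1"] by simp

lemma
  assumes "circle_measurable f" "g \<in> X" "\<And>x. norm (f x) \<le> norm (g x)"
  shows solid_mem: "f \<in> X" and solid_norm: "N f \<le> N g"
proof -
  have "\<forall>f. \<forall>g\<in>X. circle_measurable f \<and> (AE x in circle_measure. norm (f x) \<le> norm (g x))
          \<longrightarrow> f \<in> X \<and> N f \<le> N g"
    using lattice unfolding banach_lattice_on_circle_def by (elim conjE)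
  then show "f \<in> X" "N f \<le> N g" using assms by (blast intro: AE_I2)+
qed

lemma locally_integrable: "f \<in> X \<Longrightarrow> set_integrable lebesgue {a..b} f"
  by (rule banach_lattice_set_integrable[OF lattice])

lemma
  assumes g: "g \<in> X"
  shows of_real_norm_mem: "(\<lambda>x. of_real (norm (g x))) \<in> X"
    and norm_of_real_norm: "N (\<lambda>x. of_real (norm (g x))) \<le> N g"
proof -
  have "circle_measurable (\<lambda>x. of_real (norm (g x)) :: 'a)"
    using mem_circle_measurable[OF g] measurable_compose[OF _ borel_measurable_norm, of g lebesgue]
    unfolding circle_measurable_def of_real_def by auto
  from solid_mem[OF this g] solid_norm[OF this g]
  show "(\<lambda>x. of_real (norm (g x))) \<in> X" "N (\<lambda>x. of_real (norm (g x))) \<le> N g" by simp_all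
qed

lemma steklov_mem: "f \<in> X \<Longrightarrow> 0 < h \<Longrightarrow> steklov h f \<in> X"
  using bounded_averages unfolding assumption_A_def by blast

lemma steklov_bounded:
  obtains K where "0 \<le> K" and "\<And>f h. f \<in> X \<Longrightarrow> 0 < h \<Longrightarrow> N (steklov h f) \<le> K * N f"
proof -
  obtain M0 where M0: "\<And>h f. 0 < h \<Longrightarrow> f \<in> X \<Longrightarrow> N f \<le> 1 \<Longrightarrow> N (steklov h f) \<le> M0"
    using bounded_averages unfolding assumption_A_def by blast
  define M where "M = max M0 1"
  have M: "N (steklov h f) \<le> M" if "0 < h" "f \<in> X" "N f \<le> 1" for h f
    using M0[OF that] by (simp add: M_def)
  have M_pos: "0 < M" by (simp add: M_def)
  have "N (steklov h f) \<le> M * N f" if f: "f \<in> X" and h: "0 < h" for f h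
  proof (rule field_le_epsilon)
    fix e :: real assume e: "0 < e"
    \<comment> \<open>The extra \<open>e / M\<close> allows normalising \<open>f\<close> even when \<open>N f = 0\<close>.\<close>
    define d where "d = N f + e / M"
    have d: "0 < d" "N f \<le> d" using e M_pos norm_nonneg[OF f] by (auto simp: d_def add_nonneg_pos)
    have "N (\<lambda>x. of_real (1 / d) * f x) = N f / d" using d f by (subst norm_scale) (auto simp: norm_divide)
    also have "\<dots> \<le> 1" using d by simp
    finally have "N (steklov h (\<lambda>x. of_real (1 / d) * f x)) \<le> M"
      using M h scale_mem[OF f] by blast
    moreover have "steklov h (\<lambda>x. of_real (1 / d) * f x) = (\<lambda>x. of_real (1 / d) * steklov h f x)"
      by (simp add: fun_eq_iff steklov_def)
    ultimately have "N (steklov h f) / d \<le> M"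
      using d norm_scale[OF steklov_mem[OF f h], of "of_real (1 / d)"] by (simp add: norm_divide)
    then have "N (steklov h f) \<le> M * d" using d by (simp add: pos_divide_le_eq)
    then show "N (steklov h f) \<le> M * N f + e" using M_pos by (simp add: d_def distrib_left)
  qed
  then show ?thesis using M_pos by (intro that[of M]) auto
qed

text \<open>
  Fixing the bound by choice keeps the later constants independent of the step, the function and
  the level.
\<close>

definition avg_bound :: real where
  "avg_bound = (SOME K. 0 \<le> K \<and> (\<forall>f\<in>X. \<forall>h>0. N (steklov h f) \<le> K * N f))"

lemma avg_bound_nonneg: "0 \<le> avg_bound"
  and norm_steklov: "f \<in> X \<Longrightarrow> 0 < h \<Longrightarrow> N (steklov h f) \<le> avg_bound * N f"
proof -
  have "\<exists>K. 0 \<le> K \<and> (\<forall>f\<in>X. \<forall>h>0. N (steklov h f) \<le> K * N f)"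
    using steklov_bounded by metis
  from someI_ex[OF this] show "0 \<le> avg_bound"
    "f \<in> X \<Longrightarrow> 0 < h \<Longrightarrow> N (steklov h f) \<le> avg_bound * N f"
    unfolding avg_bound_def by blast+
qed

text \<open>
  The boundedness assumption concerns centred averages only, and \<open>X\<close> need not be invariant under
  translations. The one-sided interval \<open>[x, x + h]\<close> lies however in the centred interval
  \<open>[x - h, x + h]\<close> of length \<open>2 * h\<close>, so for nonnegative integrands the one-sided integral is
  dominated by \<open>2 * h\<close> times a centred average, and the lattice property does the rest.
\<close>

lemma
  assumes u: "circle_measurable u" and g: "g \<in> X" and h: "0 < h" and c: "0 \<le> c"
    and le: "\<And>x. norm (u x) \<le> c * (LINT t:{x..x + h}|lebesgue. norm (g t))"
  shows forward_dominated_mem: "u \<in> X"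
    and forward_dominated_norm: "N u \<le> 2 * c * h * avg_bound * N g"
proof -
  let ?g = "\<lambda>x. of_real (norm (g x)) :: 'a"
  let ?v = "\<lambda>x. of_real (2 * c * h) * steklov (2 * h) ?g x"
  have v: "?v \<in> X" using h by (intro scale_mem steklov_mem of_real_norm_mem g) simp
  have dom: "norm (u x) \<le> norm (?v x)" for x
  proof -
    have "norm (u x) \<le> c * (LINT t:{x..x + h}|lebesgue. norm (g t))" by (rule le)
    also have "\<dots> \<le> c * (LINT t:{x - h..x + h}|lebesgue. norm (g t))"
      using h by (intro mult_left_mono c set_integral_norm_mono locally_integrable g) auto
    also have "\<dots> \<le> \<bar>c * (LINT t:{x - h..x + h}|lebesgue. norm (g t))\<bar>" by (rule abs_ge_self)
    also have "\<dots> = norm (?v x)"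
      using h c by (simp add: steklov_of_real_norm[OF locally_integrable[OF g]] norm_mult abs_mult)
    finally show ?thesis .
  qed
  show "u \<in> X" by (rule solid_mem[OF u v dom])
  have "N u \<le> N ?v" by (rule solid_norm[OF u v dom])
  also have "\<dots> = norm (of_real (2 * c * h) :: 'a) * N (steklov (2 * h) ?g)"
    using h by (intro norm_scale steklov_mem of_real_norm_mem g) simp
  also have "\<dots> = 2 * c * h * N (steklov (2 * h) ?g)"
    using h c by (simp only: norm_of_real) simp
  also have "\<dots> \<le> 2 * c * h * (avg_bound * N g)"
  proof (intro mult_left_mono)
    have "N (steklov (2 * h) ?g) \<le> avg_bound * N ?g"
      using h by (intro norm_steklov of_real_norm_mem g) simp
    also have "\<dots> \<le> avg_bound * N g" by (intro mult_left_mono norm_of_real_norm avg_bound_nonneg g)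
    finally show "N (steklov (2 * h) ?g) \<le> avg_bound * N g" .
  qed (use h c in simp)
  finally show "N u \<le> 2 * c * h * avg_bound * N g" by (simp add: mult.assoc)
qed

lemma
  assumes f: "f \<in> X" and h: "0 < h"
  shows steklov_shifted_mem: "steklov_shifted h f \<in> X"
    and norm_steklov_shifted: "N (steklov_shifted h f) \<le> 2 * avg_bound * N f"
proof -
  have m: "circle_measurable (steklov_shifted h f)"
  proof -
    have "circle_measurable (steklov h f)" by (intro mem_circle_measurable steklov_mem f h)
    then have m: "steklov h f \<in> borel_measurable lebesgue"
      and p: "\<And>x. steklov h f (x + 2 * pi) = steklov h f x"
      unfolding circle_measurable_def by blast+
    have "steklov_shifted h f = (\<lambda>x. steklov h f (x + h / 2))"
      by (simp add: fun_eq_iff steklov_shifted_def)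
    moreover have "steklov h f (x + 2 * pi + h / 2) = steklov h f (x + h / 2)" for x
      using p[of "x + h / 2"] by (simp add: algebra_simps)
    ultimately show ?thesis
      unfolding circle_measurable_def using measurable_translate[OF m] by auto
  qed
  have le: "norm (steklov_shifted h f x) \<le> (1 / h) * (LINT t:{x..x + h}|lebesgue. norm (f t))" for x
    using h set_integral_norm_bound[OF locally_integrable[OF f]]
    by (simp add: steklov_shifted_eq divide_right_mono)
  show "steklov_shifted h f \<in> X"
    by (rule forward_dominated_mem[OF m f h _ le]) (use h in simp)
  have "N (steklov_shifted h f) \<le> 2 * (1 / h) * h * avg_bound * N f"
    by (rule forward_dominated_norm[OF m f h _ le]) (use h in simp)
  then show "N (steklov_shifted h f) \<le> 2 * avg_bound * N f" using h by simp
qed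

lemma
  assumes f: "f \<in> X" and h: "0 < h"
  shows steklov_diff_mem: "steklov_diff h f \<in> X"
    and norm_steklov_diff: "N (steklov_diff h f) \<le> (1 + 2 * avg_bound) * N f"
proof -
  have T: "steklov_diff h f = (\<lambda>x. f x - steklov_shifted h f x)"
    by (simp add: fun_eq_iff steklov_diff_def)
  show "steklov_diff h f \<in> X" unfolding T by (intro diff_mem f steklov_shifted_mem h)
  show "N (steklov_diff h f) \<le> (1 + 2 * avg_bound) * N f"
    unfolding T using norm_diff[OF f steklov_shifted_mem[OF f h]] norm_steklov_shifted[OF f h]
    by (simp add: algebra_simps)
qed

lemma
  assumes f: "f \<in> X" and h: "0 < h"
  shows steklov_diff_pow_mem: "(steklov_diff h ^^ s) f \<in> X"
    and norm_steklov_diff_pow: "N ((steklov_diff h ^^ s) f) \<le> (1 + 2 * avg_bound) ^ s * N f"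
proof -
  have "(steklov_diff h ^^ s) f \<in> X \<and> N ((steklov_diff h ^^ s) f) \<le> (1 + 2 * avg_bound) ^ s * N f"
  proof (induction s)
    case (Suc s)
    have "N (steklov_diff h ((steklov_diff h ^^ s) f)) \<le> (1 + 2 * avg_bound) * N ((steklov_diff h ^^ s) f)"
      using Suc h by (intro norm_steklov_diff) auto
    also have "\<dots> \<le> (1 + 2 * avg_bound) * ((1 + 2 * avg_bound) ^ s * N f)"
      using Suc avg_bound_nonneg by (intro mult_left_mono) auto
    finally show ?case using Suc h by (auto intro: steklov_diff_mem simp: mult.assoc)
  qed (use f in simp)
  then show "(steklov_diff h ^^ s) f \<in> X" "N ((steklov_diff h ^^ s) f) \<le> (1 + 2 * avg_bound) ^ s * N f"
    by auto
qed

lemma steklov_diff_add: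
  assumes "f \<in> X" "g \<in> X"
  shows "steklov_diff h (\<lambda>x. f x + g x) = (\<lambda>x. steklov_diff h f x + steklov_diff h g x)"
  using assms
  by (simp add: fun_eq_iff steklov_diff_def steklov_shifted_eq locally_integrable algebra_simps)

lemma steklov_diff_pow_add:
  assumes f: "f \<in> X" and g: "g \<in> X" and h: "0 < h"
  shows "(steklov_diff h ^^ s) (\<lambda>x. f x + g x) = (\<lambda>x. (steklov_diff h ^^ s) f x + (steklov_diff h ^^ s) g x)"
  by (induction s) (simp_all add: steklov_diff_add steklov_diff_pow_mem f g h)

lemma norm_steklov_diff_pow_le_add:
  assumes f: "f \<in> X" and g: "g \<in> X" and h: "0 < h"
  shows "N ((steklov_diff h ^^ s) f) \<le> N ((steklov_diff h ^^ s) g) + N ((steklov_diff h ^^ s) (\<lambda>x. f x - g x))"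
  using norm_triangle[OF steklov_diff_pow_mem[OF g h] steklov_diff_pow_mem[OF diff_mem[OF f g] h], of s s]
    steklov_diff_pow_add[OF g diff_mem[OF f g] h, of s] by simp

text \<open>
  The regularity that the Bernstein inequality gives for each of its functions, and which
  \<open>steklov_diff h\<close> preserves.
\<close>

definition smooth_in :: "(real \<Rightarrow> 'a) \<Rightarrow> bool" where
  "smooth_in g \<longleftrightarrow> (\<forall>k. (\<forall>x. iter_deriv k g differentiable (at x)) \<and> iter_deriv k g \<in> X)"

lemma smooth_in_mem: "smooth_in g \<Longrightarrow> g \<in> X"
  unfolding smooth_in_def by (drule spec[where x=0]) (simp add: iter_deriv_def)

lemma smooth_in_deriv:
  "smooth_in g \<Longrightarrow> (\<forall>x. iter_deriv k g differentiable (at x)) \<and> iter_deriv k g \<in> X"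
  unfolding smooth_in_def by blast

lemma iter_deriv_steklov_diff:
  assumes g: "smooth_in g" and h: "0 < h"
  shows "iter_deriv k (steklov_diff h g) = steklov_diff h (iter_deriv k g)"
proof (induction k)
  case 0
  then show ?case by (simp add: iter_deriv_def)
next
  case (Suc k)
  show ?case
    unfolding iter_deriv_Suc Suc
    using steklov_diff_has_vector_derivative[of "iter_deriv k g" h] smooth_in_deriv[OF g] h
    by (auto simp: fun_eq_iff iter_deriv_Suc[symmetric] intro!: vector_derivative_at)
qed

lemma smooth_in_steklov_diff:
  assumes g: "smooth_in g" and h: "0 < h"
  shows "smooth_in (steklov_diff h g)"
  unfolding smooth_in_def iter_deriv_steklov_diff[OF assms]
proof (intro allI conjI)
  fix k x
  show "steklov_diff h (iter_deriv k g) differentiable (at x)"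
    using steklov_diff_has_vector_derivative[of "iter_deriv k g" h x] smooth_in_deriv[OF g] h
    by (auto simp: iter_deriv_Suc[symmetric] intro: differentiableI_vector)
  show "steklov_diff h (iter_deriv k g) \<in> X"
    using smooth_in_deriv[OF g] h by (blast intro: steklov_diff_mem)
qed

lemma norm_steklov_diff_smooth:
  assumes g: "smooth_in g" and h: "0 < h"
  shows "N (steklov_diff h g) \<le> 2 * avg_bound * h * N (iter_deriv 1 g)"
proof -
  have g': "iter_deriv 1 g \<in> X" using smooth_in_deriv[OF g] by blast
  have eq: "iter_deriv 1 g = (\<lambda>x. vector_derivative g (at x))" by (simp add: iter_deriv_def)
  have "g differentiable (at x)" for x
    using smooth_in_deriv[OF g, of 0] by (simp add: iter_deriv_def)
  from norm_steklov_diff_le[OF this h] locally_integrable[OF g']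
  have "norm (steklov_diff h g x) \<le> 1 * (LINT t:{x..x + h}|lebesgue. norm (iter_deriv 1 g t))" for x
    unfolding eq by simp
  from forward_dominated_norm[OF _ g' h _ this]
  show ?thesis
    using mem_circle_measurable[OF steklov_diff_mem[OF smooth_in_mem[OF g] h]] by (simp add: ac_simps)
qed

text \<open>
  Each factor of \<open>steklov_diff h ^^ s\<close> is traded for a factor \<open>h\<close> and one derivative; this iterates
  because differentiation commutes with \<open>steklov_diff h\<close>.
\<close>

lemma norm_steklov_diff_pow_smooth:
  assumes "smooth_in g" and h: "0 < h"
  shows "N ((steklov_diff h ^^ s) g) \<le> (2 * avg_bound * h) ^ s * N (iter_deriv s g)"
  using assms(1)
proof (induction s arbitrary: g)
  case 0
  then show ?case by (simp add: iter_deriv_def)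
next
  case (Suc s)
  let ?K = "2 * avg_bound * h"
  have K: "0 \<le> ?K" using avg_bound_nonneg h by simp
  have "N ((steklov_diff h ^^ Suc s) g) = N ((steklov_diff h ^^ s) (steklov_diff h g))"
    by (simp only: funpow_Suc_right o_apply)
  also have "\<dots> \<le> ?K ^ s * N (steklov_diff h (iter_deriv s g))"
    using Suc.IH[OF smooth_in_steklov_diff[OF Suc.prems h]] iter_deriv_steklov_diff[OF Suc.prems h] by simp
  also have "\<dots> \<le> ?K ^ s * (?K * N (iter_deriv (Suc s) g))"
  proof (intro mult_left_mono)
    have comp: "iter_deriv k (iter_deriv s g) = iter_deriv (k + s) g" for k
      by (simp add: iter_deriv_def funpow_add)
    have "smooth_in (iter_deriv s g)"
      using smooth_in_deriv[OF Suc.prems] unfolding smooth_in_def comp by blast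
    from norm_steklov_diff_smooth[OF this h]
    show "N (steklov_diff h (iter_deriv s g)) \<le> ?K * N (iter_deriv (Suc s) g)"
      by (simp add: comp)
  qed (use K in simp)
  finally show ?case by (simp add: mult.assoc mult.left_commute)
qed

end

section \<open>The inverse estimate for Kantorovich operators\<close>

lemma linear_space_sum:
  assumes V: "linear_space V" and "finite I" and "\<And>i. i \<in> I \<Longrightarrow> g i \<in> V"
  shows "(\<lambda>x. \<Sum>i\<in>I. c i * g i x) \<in> V"
  using assms(2,3)
proof (induction I)
  case empty
  then show ?case using V by (simp add: linear_space_def)
next
  case (insert i I)
  then show ?case using V unfolding linear_space_def by simp
qed

lemma kantorovich_mem:
  assumes \<Phi>: "\<And>n. linear_space (\<Phi> n)" and K: "kantorovich_data \<Phi> \<gamma> \<gamma>' m p \<phi>"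
  shows "kantorovich \<gamma> m p \<phi> n r f \<in> \<Phi> n"
proof (cases "n = 0")
  case True
  then have "kantorovich \<gamma> m p \<phi> n r f = (\<lambda>x. 0)" by (simp add: fun_eq_iff kantorovich_def)
  then show ?thesis using \<Phi>[of n] by (simp add: linear_space_def)
next
  case False
  then have "kantorovich \<gamma> m p \<phi> n r f
      = (\<lambda>x. \<Sum>k=1..m n. steklov_comb (\<gamma> / real n) r f (p k n) * \<phi> k n x)"
    by (simp add: fun_eq_iff kantorovich_def)
  also have "\<dots> \<in> \<Phi> n"
    using K False by (intro linear_space_sum \<Phi>) (auto simp: kantorovich_data_def)
  finally show ?thesis .
qed

theorem theorem3p2:
  fixes X :: "(real \<Rightarrow> 'a::{real_normed_field, euclidean_space}) set"
    and N :: "(real \<Rightarrow> 'a) \<Rightarrow> real"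
    and \<Phi> :: "nat \<Rightarrow> (real \<Rightarrow> 'a) set"
    and \<gamma> \<gamma>' :: real
    and m :: "nat \<Rightarrow> nat"
    and p :: "nat \<Rightarrow> nat \<Rightarrow> real"
    and \<phi> :: "nat \<Rightarrow> nat \<Rightarrow> real \<Rightarrow> 'a"
    and r s :: nat
  assumes "banach_lattice_on_circle X N"
    and "assumption_A X N"
    and "bernstein_family X N \<Phi>"
    and "kantorovich_data \<Phi> \<gamma> \<gamma>' m p \<phi>"
    and "r \<ge> 1" and "s \<ge> 1"
  shows "\<exists>C>0. \<forall>f\<in>X. \<forall>n\<ge>1.
           ((\<lambda>g x. g x - steklov_shifted (\<gamma> / real n) g x) ^^ s) f \<in> X
           \<and> N (((\<lambda>g x. g x - steklov_shifted (\<gamma> / real n) g x) ^^ s) f)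
             \<le> C / real n ^ s *
               (\<Sum>\<nu>=0..n. real (\<nu> + 1) ^ (s - 1) * N (\<lambda>x. f x - kantorovich \<gamma> m p \<phi> \<nu> r f x))"
proof -
  interpret steklov_lattice X N by unfold_locales fact+
  have \<gamma>: "0 < \<gamma>" using assms(4) by (simp add: kantorovich_data_def)
  have \<Phi>: "linear_space (\<Phi> n)" "\<Phi> n \<subseteq> X" for n
    using assms(3) unfolding bernstein_family_def by blast+
  have nested: "i \<le> j \<Longrightarrow> \<Phi> i \<subseteq> \<Phi> j" for i j
    using assms(3) unfolding bernstein_family_def by blast
  obtain B where B: "0 < B" and bern: "\<And>n g k. g \<in> \<Phi> n \<Longrightarrow> (\<forall>x. iter_deriv k g differentiable (at x))
      \<and> iter_deriv k g \<in> X \<and> N (iter_deriv k g) \<le> (B * real n) ^ k * N g"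
    using assms(3) unfolding bernstein_family_def by blast
  define M where "M = (1 + 2 * avg_bound) ^ s"
  define D where "D = (2 * avg_bound * \<gamma> * B) ^ s"
  define C where "C = 2 ^ s * (M + D) + 2 * 6 ^ s * D"
  have M: "0 < M" and D: "0 \<le> D" using avg_bound_nonneg \<gamma> B by (auto simp: M_def D_def)
  have "0 < C" using M D by (auto simp: C_def intro!: add_pos_nonneg)
  moreover have "(steklov_diff (\<gamma> / real n) ^^ s) f \<in> X
      \<and> N ((steklov_diff (\<gamma> / real n) ^^ s) f) \<le> C / real n ^ s *
        (\<Sum>\<nu>=0..n. real (\<nu> + 1) ^ (s - 1) * N (\<lambda>x. f x - kantorovich \<gamma> m p \<phi> \<nu> r f x))"
    if f: "f \<in> X" and n: "1 \<le> n" for f n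
  proof
    define h where "h = \<gamma> / real n"
    define T :: "(real \<Rightarrow> 'a) \<Rightarrow> real \<Rightarrow> 'a" where "T = steklov_diff h ^^ s"
    define K where "K \<nu> = kantorovich \<gamma> m p \<phi> \<nu> r f" for \<nu>
    define a where "a \<nu> = N (\<lambda>x. f x - K \<nu> x)" for \<nu>
    have h: "0 < h" using \<gamma> n by (simp add: h_def)
    have K\<Phi>: "K \<nu> \<in> \<Phi> \<nu>" for \<nu> unfolding K_def by (rule kantorovich_mem[OF \<Phi>(1) assms(4)])
    then have KX: "K \<nu> \<in> X" for \<nu> using \<Phi>(2) by blast
    show "(steklov_diff (\<gamma> / real n) ^^ s) f \<in> X"
      by (rule steklov_diff_pow_mem[OF f h[unfolded h_def]])
    have a: "0 \<le> a \<nu>" for \<nu> unfolding a_def by (intro norm_nonneg diff_mem f KX)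
    have K0: "N (T (K 0)) = 0"
    proof -
      have "K 0 = (\<lambda>x. 0)" by (simp add: K_def kantorovich_def fun_eq_iff)
      then have "N (T (K 0)) \<le> 0"
        unfolding T_def using norm_steklov_diff_pow[OF zero_mem h, of s] norm_zero by simp
      then show ?thesis
        using norm_nonneg[OF steklov_diff_pow_mem[OF KX h]] unfolding T_def by (simp add: order_antisym)
    qed
    have step: "N (T (K \<nu>)) \<le> N (T (K \<mu>)) + D / real n ^ s * real \<nu> ^ s * (a \<nu> + a \<mu>)"
      if "\<mu> \<le> \<nu>" for \<mu> \<nu>
    proof -
      let ?d = "\<lambda>x. K \<nu> x - K \<mu> x"
      have "K \<mu> \<in> \<Phi> \<nu>" using K\<Phi> nested[OF that] by blast
      then have d: "?d \<in> \<Phi> \<nu>" by (intro linear_space_diff \<Phi>(1) K\<Phi>)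
      have d_le: "N ?d \<le> a \<mu> + a \<nu>"
        using norm_diff[OF diff_mem[OF f KX] diff_mem[OF f KX], of \<mu> \<nu>] by (simp add: a_def)
      have "N (T ?d) \<le> (2 * avg_bound * h) ^ s * N (iter_deriv s ?d)"
        unfolding T_def using bern[OF d] h by (intro norm_steklov_diff_pow_smooth) (auto simp: smooth_in_def)
      also have "\<dots> \<le> (2 * avg_bound * h) ^ s * ((B * real \<nu>) ^ s * N ?d)"
        using bern[OF d] h avg_bound_nonneg by (intro mult_left_mono) auto
      also have "\<dots> = D / real n ^ s * real \<nu> ^ s * N ?d"
        by (simp add: D_def h_def power_mult_distrib power_divide)
      also have "\<dots> \<le> D / real n ^ s * real \<nu> ^ s * (a \<nu> + a \<mu>)"
        using D d_le by (intro mult_left_mono) auto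
      finally show ?thesis
        using norm_steklov_diff_pow_le_add[OF KX KX h, of s \<nu> \<mu>] unfolding T_def by simp
    qed
    have "N (T f) \<le> M * a \<mu> + N (T (K \<mu>))" for \<mu>
      using norm_steklov_diff_pow_le_add[OF f KX h, of s \<mu>]
        norm_steklov_diff_pow[OF diff_mem[OF f KX] h, of s \<mu>] by (simp add: T_def M_def a_def)
    from weighted_inverse_estimate[where b = "\<lambda>\<nu>. N (T (K \<nu>))", OF a D less_imp_le[OF M] assms(6) n K0 step this]
    show "N ((steklov_diff (\<gamma> / real n) ^^ s) f) \<le> C / real n ^ s *
        (\<Sum>\<nu>=0..n. real (\<nu> + 1) ^ (s - 1) * N (\<lambda>x. f x - kantorovich \<gamma> m p \<phi> \<nu> r f x))"
      unfolding C_def T_def h_def K_def a_def .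
  qed
  moreover have "(\<lambda>(g :: real \<Rightarrow> 'a) x. g x - steklov_shifted h g x) = steklov_diff h"
    for h :: real by (simp add: fun_eq_iff steklov_diff_def)
  ultimately show ?thesis by auto
qed

end
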